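(* Let $A$ be a Hilbert algebra, and let $CE$ be the bounded poset of all closure endomorphisms of $A$, ordered pointwise. The transformation $\phi \mapsto F_\phi := \{x\in A : \phi x = x\}$ is an order embedding of the bounded poset $CE$ into the dual of the poset of special subalgebras of $A$ (ordered by inclusion). Its range consists exactly of the special closure retracts of $A$, which (ordered by inclusion) form a lattice with meet $\cap$ and join $\nabla$, where $S \,\nabla\, T = \{x \wedge y : x \in S,\ y \in T,\ x \text{ and } y \text{ compatible}\}$. If $\phi\in CE$ and $R = F_\phi$, then, for all $a\in A$, $\phi a = \min [a)_R$, where $[a)_R := \{x\in R : a \le x\}$.
   Context: A Hilbert algebra $(A,\to,1)$ is a poset with greatest element $1$ and a binary operation $\to$ such that $x \to y = 1$ iff $x \le y$; $x \le y \to x$; and $x \to (y \to z) \le (x \to y) \to (x \to z)$. A closure endomorphism of $A$ is a map $\phi\colon A\to A$ that is an endomorphism ($\phi(x\to y)=\phi x\to\phi y$) and a closure operator (isotone, $x\le\phi x$, $\phi\phi x=\phi x$). The set $CE$ of all closure endomorphisms, ordered pointwise, has least element $\varepsilon\colon x\mapsto x$ and greatest element $\iota\colon x\mapsto 1$. A subset $S\subseteq A$ is special if for every $a\in A$ and $b\in S$ there is $p\in A$ such that $p\to a\in S$ and $p\to b=b$. A special subalgebra is a subalgebra of $(A,\to,1)$ that is special. A subset $R\subseteq A$ is a closure retract if for every $a\in A$ the set $[a)_R=\{x\in R: a\le x\}$ has a least element; a special closure retract is a closure retract that is special. Elements $a,b\in A$ are compatible if they have a lower bound $c$ such that $a\le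 b\to c$; such a $c$ is necessarily the meet $a\wedge b$. *)

theory Defs
  imports "HOL-Algebra.Lattice"
begin

class hilbert_algebra = order + one +
  fixes imp :: "'a \<Rightarrow> 'a \<Rightarrow> 'a" (infixr "\<leadsto>" 60)
  assumes le_one: "x \<le> 1"
    and imp_eq_one_iff: "x \<leadsto> y = 1 \<longleftrightarrow> x \<le> y"
    and le_imp: "x \<le> y \<leadsto> x"
    and imp_imp_le: "x \<leadsto> (y \<leadsto> z) \<le> (x \<leadsto> y) \<leadsto> (x \<leadsto> z)"

definition closure_endomorphism :: "('a::hilbert_algebra \<Rightarrow> 'a) \<Rightarrow> bool" where
  "closure_endomorphism \<phi> \<longleftrightarrow>
     (\<forall>x y. \<phi> (x \<leadsto> y) = \<phi> x \<leadsto> \<phi> y) \<and>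
     mono \<phi> \<and> (\<forall>x. x \<le> \<phi> x) \<and> (\<forall>x. \<phi> (\<phi> x) = \<phi> x)"

text \<open>Here \<open>\<le>\<close> is the library's order on functions, which is the pointwise one.\<close>

definition CE :: "('a::hilbert_algebra \<Rightarrow> 'a) gorder" where
  "CE = \<lparr>carrier = {\<phi>. closure_endomorphism \<phi>}, eq = (=), le = (\<le>)\<rparr>"

definition inclusion_poset :: "'a set set \<Rightarrow> 'a set gorder" where
  "inclusion_poset \<C> = \<lparr>carrier = \<C>, eq = (=), le = (\<subseteq>)\<rparr>"

definition fixpoint_set :: "('a \<Rightarrow> 'a) \<Rightarrow> 'a set" where
  "fixpoint_set \<phi> = {x. \<phi> x = x}"

definition special :: "'a::hilbert_algebra set \<Rightarrow> bool" where
  "special S \<longleftrightarrow> (\<forall>a. \<forall>b\<in>S. \<exists>p. p \<leadsto> a \<in> S \<and> p \<leadsto> b = b)"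

definition subalgebra :: "'a::hilbert_algebra set \<Rightarrow> bool" where
  "subalgebra S \<longleftrightarrow> 1 \<in> S \<and> (\<forall>x\<in>S. \<forall>y\<in>S. x \<leadsto> y \<in> S)"

definition special_subalgebra :: "'a::hilbert_algebra set \<Rightarrow> bool" where
  "special_subalgebra S \<longleftrightarrow> subalgebra S \<and> special S"

definition special_subalgebras :: "'a::hilbert_algebra set gorder" where
  "special_subalgebras = inclusion_poset {S. special_subalgebra S}"

definition upper_part :: "'a::order set \<Rightarrow> 'a \<Rightarrow> 'a set" where
  "upper_part R a = {x \<in> R. a \<le> x}"

text \<open>The library's \<open>Min\<close> is only meaningful for finite sets, hence a relation.\<close>

definition is_minimum :: "'a::order set \<Rightarrow> 'a \<Rightarrow> bool" where
  "is_minimum X m \<longleftrightarrow> m \<in> X \<and> (\<forall>x\<in>X. m \<le> x)"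

definition closure_retract :: "'a::order set \<Rightarrow> bool" where
  "closure_retract R \<longleftrightarrow> (\<forall>a. \<exists>m. is_minimum (upper_part R a) m)"

definition special_closure_retract :: "'a::hilbert_algebra set \<Rightarrow> bool" where
  "special_closure_retract R \<longleftrightarrow> closure_retract R \<and> special R"

definition special_closure_retracts :: "'a::hilbert_algebra set gorder" where
  "special_closure_retracts = inclusion_poset {R. special_closure_retract R}"

definition compatible :: "'a::hilbert_algebra \<Rightarrow> 'a \<Rightarrow> bool" where
  "compatible a b \<longleftrightarrow> (\<exists>c. c \<le> a \<and> c \<le> b \<and> a \<le> b \<leadsto> c)"

text \<open>\<open>order_emb\<close> does not require that the map send the carrier into the carrier. The bounds
  are preserved in the sense that least and greatest elements go to least and greatest ones.\<close>

definition bounded_order_embedding :: "'a gorder \<Rightarrow> 'b gorder \<Rightarrow> ('a \<Rightarrow> 'b) \<Rightarrow> bool" where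
  "bounded_order_embedding P Q f \<longleftrightarrow>
     f \<in> carrier P \<rightarrow> carrier Q \<and> order_emb P Q f \<and>
     (\<forall>x. least P x (carrier P) \<longrightarrow> least Q (f x) (carrier Q)) \<and>
     (\<forall>x. greatest P x (carrier P) \<longrightarrow> greatest Q (f x) (carrier Q))"

text \<open>A Hilbert algebra need not be a meet semilattice; \<open>wedge x y\<close> is the meet whenever it
  exists, in particular for compatible \<open>x\<close> and \<open>y\<close>, and is unspecified otherwise.\<close>

definition wedge :: "'a::order \<Rightarrow> 'a \<Rightarrow> 'a" where
  "wedge x y = (GREATEST z. z \<le> x \<and> z \<le> y)"

definition nabla :: "'a::hilbert_algebra set \<Rightarrow> 'a set \<Rightarrow> 'a set" (infixl "\<nabla>" 65) where
  "S \<nabla> T = {wedge x y | x y. x \<in> S \<and> y \<in> T \<and> compatible x y}"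

end

theory Submission
  imports Defs
begin

text \<open>
  Everything rests on the identity \<open>\<phi> (x \<leadsto> y) = x \<leadsto> \<phi> y\<close>. Among closure operators it
  characterises the closure endomorphisms (\<open>closure_endomorphism_iff\<close>), and it is much easier to
  verify than the homomorphism law, because \<open>\<phi>\<close> occurs in it on the right only.

  A closure operator maps each element to the least fixpoint above it. Its fixpoints therefore
  form a closure retract and determine it, and a larger operator has fewer of them. The
  fixpoint set of a closure endomorphism \<open>\<phi>\<close> is special, since \<open>p = \<phi> a \<leadsto> a\<close> satisfies
  \<open>\<phi> p = 1\<close> and \<open>p \<leadsto> a = \<phi> a\<close>: the value \<open>\<phi> a\<close> is itself an implication into
  \<open>a\<close> whose premise \<open>p\<close> cannot be distinguished from \<open>1\<close> by fixpoints. Conversely, if \<open>R\<close> is a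
  special closure retract, let \<open>\<phi> a\<close> be the least element of \<open>R\<close> above \<open>a\<close>. The elements \<open>p\<close>
  provided by specialness show that \<open>x \<leadsto> b \<in> R\<close> for \<open>b \<in> R\<close> and arbitrary \<open>x\<close>, which gives one
  half of \<open>\<phi> (x \<leadsto> y) = x \<leadsto> \<phi> y\<close>, and that \<open>x \<leadsto> \<phi> y\<close> lies below every element of \<open>R\<close>
  above \<open>x \<leadsto> y\<close>, which gives the other.

  For the lattice operations it is therefore enough to work with closure endomorphisms. The
  composite \<open>\<psi> \<circ> \<phi>\<close> clearly satisfies the identity, and it is idempotent because \<open>\<psi>\<close> maps
  fixpoints of \<open>\<phi>\<close> to fixpoints of \<open>\<phi>\<close>; its fixpoints are those common to \<open>\<phi>\<close> and \<open>\<psi>\<close>. Dually,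
  \<open>\<phi> a\<close> and \<open>\<psi> a\<close> always have the meet \<open>(\<phi> a \<leadsto> (\<psi> a \<leadsto> a)) \<leadsto> a\<close>, with respect to which they
  are compatible. The term comes from Heyting algebras, where the meet \<open>m\<close> of two elements
  \<open>p \<leadsto> a\<close> and \<open>q \<leadsto> a\<close> is \<open>(p \<or> q) \<leadsto> a\<close> and hence equals \<open>(m \<leadsto> a) \<leadsto> a\<close>. Implication
  distributes over compatible meets, so the pointwise meet of \<open>\<phi>\<close> and \<open>\<psi>\<close> again satisfies the
  identity, and its fixpoints are exactly the meets of compatible pairs of fixpoints.
\<close>

section \<open>Implication in Hilbert algebras\<close>

lemma one_le_iff: "1 \<le> x \<longleftrightarrow> x = (1 :: 'a :: hilbert_algebra)"
  using le_one[of x] by auto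

lemma imp_mono_right:
  fixes x :: "'a :: hilbert_algebra"
  assumes "y \<le> z"
  shows "x \<leadsto> y \<le> x \<leadsto> z"
proof -
  have "x \<leadsto> (y \<leadsto> z) = 1"
    using assms le_one by (metis imp_eq_one_iff)
  then show ?thesis
    by (metis imp_imp_le one_le_iff imp_eq_one_iff)
qed

lemma modus_ponens:
  fixes x :: "'a :: hilbert_algebra"
  assumes "z \<le> x \<leadsto> y" and "z \<le> x"
  shows "z \<le> y"
proof -
  have "(z \<leadsto> x) \<leadsto> (z \<leadsto> y) = 1"
    using assms(1) by (metis imp_imp_le one_le_iff imp_eq_one_iff)
  moreover have "z \<leadsto> x = 1"
    using assms(2) by (simp add: imp_eq_one_iff)
  ultimately show ?thesis
    by (metis imp_eq_one_iff one_le_iff)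
qed

lemma one_imp: "1 \<leadsto> x = (x :: 'a :: hilbert_algebra)"
  by (meson antisym le_imp le_one modus_ponens order_refl)

lemma imp_swap:
  fixes x :: "'a :: hilbert_algebra"
  assumes "z \<le> x \<leadsto> y"
  shows "x \<le> z \<leadsto> y"
proof -
  have "z \<leadsto> x \<le> z \<leadsto> y"
    using assms by (metis imp_imp_le one_le_iff imp_eq_one_iff)
  then show ?thesis
    using le_imp order_trans by blast
qed

lemma le_imp_imp: "x \<le> (x \<leadsto> y) \<leadsto> (y :: 'a :: hilbert_algebra)"
  by (rule imp_swap) simp

lemma imp_antimono_left:
  fixes x :: "'a :: hilbert_algebra"
  assumes "x \<le> y"
  shows "y \<leadsto> z \<le> x \<leadsto> z"
  using assms by (meson imp_swap le_imp_imp order_trans)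

lemma imp_exchange: "x \<leadsto> (y \<leadsto> z) = y \<leadsto> (x \<leadsto> (z :: 'a :: hilbert_algebra))"
proof -
  have "u \<leadsto> (v \<leadsto> z) \<le> v \<leadsto> (u \<leadsto> z)" for u v :: 'a
    by (rule order_trans[OF imp_imp_le imp_antimono_left[OF le_imp]])
  then show ?thesis
    by (simp add: antisym)
qed

section \<open>Compatible elements\<close>

lemma compatible_meet:
  fixes a b c :: "'a :: hilbert_algebra"
  assumes "c \<le> a" and "c \<le> b" and "a \<le> b \<leadsto> c"
  shows "wedge a b = c" and "\<And>z. z \<le> a \<Longrightarrow> z \<le> b \<Longrightarrow> z \<le> c"
proof -
  show *: "z \<le> c" if "z \<le> a" "z \<le> b" for z
    using that assms(3) by (meson modus_ponens order_trans)
  show "wedge a b = c"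
    unfolding wedge_def using assms * by (intro Greatest_equality) auto
qed

lemma compatible_wedge:
  fixes a b :: "'a :: hilbert_algebra"
  assumes "compatible a b"
  shows "wedge a b \<le> a" and "wedge a b \<le> b" and "a \<le> b \<leadsto> wedge a b"
    and "\<And>z. z \<le> a \<Longrightarrow> z \<le> b \<Longrightarrow> z \<le> wedge a b"
proof -
  obtain c where c: "c \<le> a" "c \<le> b" "a \<le> b \<leadsto> c"
    using assms unfolding compatible_def by blast
  with compatible_meet(1)[OF c]
  show "wedge a b \<le> a" "wedge a b \<le> b" "a \<le> b \<leadsto> wedge a b"
    by simp_all
  show "z \<le> wedge a b" if "z \<le> a" "z \<le> b" for z
    using compatible_meet[OF c] that by simp
qed

lemma compatible_one:
  fixes a :: "'a :: hilbert_algebra"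
  shows "compatible a 1" and "wedge a 1 = a" and "compatible 1 a" and "wedge 1 a = a"
proof -
  have c: "a \<le> a" "a \<le> 1" "a \<le> 1 \<leadsto> a" "1 \<le> a \<leadsto> a"
    by (simp_all add: le_one le_imp imp_eq_one_iff one_le_iff)
  show "compatible a 1" "compatible 1 a"
    unfolding compatible_def using c by blast+
  show "wedge a 1 = a" "wedge 1 a = a"
    using c by (auto intro: compatible_meet(1))
qed

text \<open>
  Implication preserves every existing meet in a Heyting algebra. In a Hilbert algebra
  compatibility replaces the missing residuation: \<open>b \<le> c \<leadsto> b \<and> c\<close> is an inequality between
  implications and can be prefixed by \<open>x\<close>.
\<close>

lemma le_imp_wedge:
  fixes b c :: "'a :: hilbert_algebra"
  assumes "compatible b c" and "z \<le> x \<leadsto> b" and "z \<le> x \<leadsto> c"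
  shows "z \<le> x \<leadsto> wedge b c"
proof -
  have "z \<le> x \<leadsto> (c \<leadsto> wedge b c)"
    using assms(2) imp_mono_right[OF compatible_wedge(3)[OF assms(1)]] by (rule order_trans)
  then have "z \<le> (x \<leadsto> c) \<leadsto> (x \<leadsto> wedge b c)"
    using imp_imp_le by (rule order_trans)
  then show ?thesis
    using assms(3) by (rule modus_ponens)
qed

section \<open>Closure endomorphisms\<close>

lemma closure_endomorphismD:
  assumes "closure_endomorphism \<phi>"
  shows "\<phi> (x \<leadsto> y) = \<phi> x \<leadsto> \<phi> y" and "x \<le> y \<Longrightarrow> \<phi> x \<le> \<phi> y" and "x \<le> \<phi> x"
    and "\<phi> (\<phi> x) = \<phi> x"
  using assms unfolding closure_endomorphism_def by (auto dest: monoD)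

lemma closure_endomorphism_one:
  assumes "closure_endomorphism \<phi>"
  shows "\<phi> 1 = 1"
  using closure_endomorphismD(3)[OF assms, of 1] by (simp add: one_le_iff)

lemma closure_endomorphism_imp:
  assumes "closure_endomorphism \<phi>"
  shows "\<phi> (x \<leadsto> y) = x \<leadsto> \<phi> y"
proof (rule antisym)
  note \<phi> = closure_endomorphismD[OF assms]
  show "\<phi> (x \<leadsto> y) \<le> x \<leadsto> \<phi> y"
    using imp_antimono_left[OF \<phi>(3)] by (simp add: \<phi>(1))
  show "x \<leadsto> \<phi> y \<le> \<phi> (x \<leadsto> y)"
    using \<phi>(3)[of "x \<leadsto> \<phi> y"] by (simp add: \<phi>(1,4))
qed

text \<open>
  To derive the homomorphism law from the identity, note that \<open>u = x \<leadsto> \<phi> y\<close> is a fixpoint,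
  and so is \<open>u \<leadsto> \<phi> y\<close>. The latter is above \<open>x\<close>, hence above \<open>\<phi> x\<close>, and exchanging premises turns this into \<open>u \<le> \<phi> x \<leadsto> \<phi> y\<close>.
\<close>

lemma closure_endomorphism_iff:
  "closure_endomorphism \<phi> \<longleftrightarrow>
     (\<forall>x y. \<phi> (x \<leadsto> y) = x \<leadsto> \<phi> y) \<and> mono \<phi> \<and> (\<forall>x. x \<le> \<phi> x) \<and> (\<forall>x. \<phi> (\<phi> x) = \<phi> x)"
    (is "_ \<longleftrightarrow> ?rhs")
proof
  assume "closure_endomorphism \<phi>"
  then show ?rhs
    using closure_endomorphism_imp unfolding closure_endomorphism_def by blast
next
  assume r: ?rhs
  then have imp: "\<phi> (x \<leadsto> y) = x \<leadsto> \<phi> y" and mono: "x \<le> y \<Longrightarrow> \<phi> x \<le> \<phi> y"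
    and ext: "x \<le> \<phi> x" and idem: "\<phi> (\<phi> x) = \<phi> x" for x y
    by (auto dest: monoD)
  have "x \<leadsto> \<phi> y = \<phi> x \<leadsto> \<phi> y" for x y
  proof (rule antisym)
    have "\<phi> x \<le> \<phi> ((x \<leadsto> \<phi> y) \<leadsto> \<phi> y)"
      by (rule mono[OF le_imp_imp])
    also have "\<dots> = (x \<leadsto> \<phi> y) \<leadsto> \<phi> y"
      by (simp add: imp idem)
    finally show "x \<leadsto> \<phi> y \<le> \<phi> x \<leadsto> \<phi> y"
      by (rule imp_swap)
    show "\<phi> x \<leadsto> \<phi> y \<le> x \<leadsto> \<phi> y"
      by (rule imp_antimono_left[OF ext])
  qed
  with r show "closure_endomorphism \<phi>"
    unfolding closure_endomorphism_def by simp
qed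

lemma closure_endomorphism_id: "closure_endomorphism id"
  unfolding closure_endomorphism_def by (auto intro: monoI)

lemma closure_endomorphism_const_one: "closure_endomorphism (\<lambda>_. 1)"
  unfolding closure_endomorphism_def by (auto intro: monoI simp: le_one one_imp)

text \<open>
  By the identity for \<open>\<psi>\<close>, \<open>\<phi> (\<psi> z) \<leadsto> \<psi> z = \<psi> (\<phi> (\<psi> z) \<leadsto> z)\<close>. As \<open>z\<close> is a fixpoint of
  \<open>\<phi>\<close>, the outer \<open>\<phi>\<close> can be dropped from this premise, and what remains is
  \<open>\<psi> z \<leadsto> \<psi> z = 1\<close>. This is what makes composites of closure endomorphisms idempotent.
\<close>

lemma closure_endomorphism_preserves_fixpoints:
  assumes \<phi>: "closure_endomorphism \<phi>" and \<psi>: "closure_endomorphism \<psi>" and z: "\<phi> z = z"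
  shows "\<phi> (\<psi> z) = \<psi> z"
proof (rule antisym)
  have "\<phi> (\<psi> z) \<leadsto> z = \<psi> z \<leadsto> z"
    using closure_endomorphismD(1)[OF \<phi>, of "\<psi> z" z] closure_endomorphism_imp[OF \<phi>, of "\<psi> z" z]
    by (simp add: z)
  then have "\<phi> (\<psi> z) \<leadsto> \<psi> z = \<psi> z \<leadsto> \<psi> z"
    using closure_endomorphism_imp[OF \<psi>, of _ z] by metis
  then show "\<phi> (\<psi> z) \<le> \<psi> z"
    by (metis imp_eq_one_iff order_refl)
  show "\<psi> z \<le> \<phi> (\<psi> z)"
    by (rule closure_endomorphismD(3)[OF \<phi>])
qed

lemma closure_endomorphism_comp:
  assumes \<phi>: "closure_endomorphism \<phi>" and \<psi>: "closure_endomorphism \<psi>"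
  shows "closure_endomorphism (\<psi> \<circ> \<phi>)"
  unfolding closure_endomorphism_iff
proof (intro conjI allI monoI)
  fix x y
  show "(\<psi> \<circ> \<phi>) (x \<leadsto> y) = x \<leadsto> (\<psi> \<circ> \<phi>) y"
    using assms by (simp add: closure_endomorphism_imp)
  show "x \<le> (\<psi> \<circ> \<phi>) x"
    using order_trans[OF closure_endomorphismD(3)[OF \<phi>] closure_endomorphismD(3)[OF \<psi>]] by simp
  show "x \<le> y \<Longrightarrow> (\<psi> \<circ> \<phi>) x \<le> (\<psi> \<circ> \<phi>) y"
    using assms by (simp add: closure_endomorphismD(2))
  show "(\<psi> \<circ> \<phi>) ((\<psi> \<circ> \<phi>) x) = (\<psi> \<circ> \<phi>) x"
    using closure_endomorphism_preserves_fixpoints[OF \<phi> \<psi>] closure_endomorphismD(4)[OF \<phi>]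
      closure_endomorphismD(4)[OF \<psi>] by simp
qed

lemma fixpoint_set_comp:
  assumes \<phi>: "closure_endomorphism \<phi>" and \<psi>: "closure_endomorphism \<psi>"
  shows "fixpoint_set (\<psi> \<circ> \<phi>) = fixpoint_set \<phi> \<inter> fixpoint_set \<psi>"
proof -
  \<comment> \<open>A fixpoint of the composite satisfies \<open>x \<le> \<phi> x \<le> \<psi> (\<phi> x) = x\<close>.\<close>
  have "\<phi> x = x" if "\<psi> (\<phi> x) = x" for x
    using closure_endomorphismD(3)[OF \<phi>, of x] closure_endomorphismD(3)[OF \<psi>, of "\<phi> x"] that
    by (simp add: antisym)
  then show ?thesis
    unfolding fixpoint_set_def by (auto, metis)
qed

text \<open>
  The reason is that \<open>\<phi> (\<phi> a \<leadsto> a) = \<phi> a \<leadsto> \<phi> a = 1\<close>, so that \<open>\<phi>\<close> sends the left-hand side to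
  \<open>\<phi> a\<close>.
\<close>

lemma closure_endomorphism_imp_imp:
  assumes "closure_endomorphism \<phi>"
  shows "(\<phi> a \<leadsto> a) \<leadsto> a = \<phi> a"
proof (rule antisym)
  note \<phi> = closure_endomorphismD[OF assms]
  have "\<phi> (\<phi> a \<leadsto> a) = 1"
    using \<phi>(1,4) by (simp add: imp_eq_one_iff)
  then have "\<phi> ((\<phi> a \<leadsto> a) \<leadsto> a) = \<phi> a"
    by (simp add: \<phi>(1) one_imp)
  then show "(\<phi> a \<leadsto> a) \<leadsto> a \<le> \<phi> a"
    using \<phi>(3)[of "(\<phi> a \<leadsto> a) \<leadsto> a"] by simp
  show "\<phi> a \<le> (\<phi> a \<leadsto> a) \<leadsto> a"
    by (rule le_imp_imp)
qed

text \<open>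
  The lower bound \<open>c = (\<phi> a \<leadsto> (\<psi> a \<leadsto> a)) \<leadsto> a\<close> is what the meet would be in a Heyting algebra.
  It is smaller than \<open>(\<phi> a \<leadsto> a) \<leadsto> a\<close> and \<open>(\<psi> a \<leadsto> a) \<leadsto> a\<close> since it has a weaker premise, and by
  the preceding lemma these are \<open>\<phi> a\<close> and \<open>\<psi> a\<close>.
\<close>

lemma closure_endomorphisms_compatible:
  assumes \<phi>: "closure_endomorphism \<phi>" and \<psi>: "closure_endomorphism \<psi>"
  shows "compatible (\<phi> a) (\<psi> a)"
proof -
  define c where "c = (\<phi> a \<leadsto> (\<psi> a \<leadsto> a)) \<leadsto> a"
  have "c \<le> (\<phi> a \<leadsto> a) \<leadsto> a"
    unfolding c_def by (intro imp_antimono_left imp_mono_right le_imp)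
  then have 1: "c \<le> \<phi> a"
    by (simp add: closure_endomorphism_imp_imp[OF \<phi>])
  have "c \<le> (\<psi> a \<leadsto> a) \<leadsto> a"
    unfolding c_def by (intro imp_antimono_left le_imp)
  then have 2: "c \<le> \<psi> a"
    by (simp add: closure_endomorphism_imp_imp[OF \<psi>])
  \<comment> \<open>Exchange moves the outer premise of \<open>c\<close> to the front of \<open>\<phi> a \<leadsto> (\<psi> a \<leadsto> c)\<close>.\<close>
  let ?p = "\<phi> a \<leadsto> (\<psi> a \<leadsto> a)"
  have "\<phi> a \<leadsto> (\<psi> a \<leadsto> c) = \<phi> a \<leadsto> (?p \<leadsto> (\<psi> a \<leadsto> a))"
    unfolding c_def by (subst imp_exchange[of "\<psi> a"]) (rule refl)
  also have "\<dots> = ?p \<leadsto> ?p"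
    by (rule imp_exchange)
  finally have "\<phi> a \<le> \<psi> a \<leadsto> c"
    by (metis imp_eq_one_iff order_refl)
  with 1 2 show ?thesis
    unfolding compatible_def by blast
qed

lemma closure_endomorphism_wedge:
  fixes \<phi> \<psi> :: "'a :: hilbert_algebra \<Rightarrow> 'a"
  assumes \<phi>: "closure_endomorphism \<phi>" and \<psi>: "closure_endomorphism \<psi>"
  shows "closure_endomorphism (\<lambda>a. wedge (\<phi> a) (\<psi> a))"
proof -
  note D = closure_endomorphismD[OF \<phi>] and E = closure_endomorphismD[OF \<psi>]
  note W = compatible_wedge[OF closure_endomorphisms_compatible[OF \<phi> \<psi>]]
  let ?\<theta> = "\<lambda>a. wedge (\<phi> a) (\<psi> a)"
  have ext: "x \<le> ?\<theta> x" for x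
    using D(3) E(3) by (rule W(4))
  have mono: "?\<theta> x \<le> ?\<theta> y" if "x \<le> y" for x y
    using that D(2) E(2) W(1,2) by (meson W(4) order_trans)
  have idem: "?\<theta> (?\<theta> x) = ?\<theta> x" for x
  proof (rule antisym)
    have "\<phi> (?\<theta> x) \<le> \<phi> x" "\<psi> (?\<theta> x) \<le> \<psi> x"
      using D(2)[OF W(1)] E(2)[OF W(2)] by (simp_all add: D(4) E(4))
    then show "?\<theta> (?\<theta> x) \<le> ?\<theta> x"
      by (meson W order_trans)
  qed (rule ext)
  have imp: "?\<theta> (x \<leadsto> y) = x \<leadsto> ?\<theta> y" for x y
  proof (rule antisym)
    show "?\<theta> (x \<leadsto> y) \<le> x \<leadsto> ?\<theta> y"
      using W(1,2)[of "x \<leadsto> y"] closure_endomorphism_imp[OF \<phi>] closure_endomorphism_imp[OF \<psi>]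
      by (intro le_imp_wedge closure_endomorphisms_compatible \<phi> \<psi>) metis+
    show "x \<leadsto> ?\<theta> y \<le> ?\<theta> (x \<leadsto> y)"
      using imp_mono_right[OF W(1)] imp_mono_right[OF W(2)]
      by (intro W(4)) (simp_all only: closure_endomorphism_imp[OF \<phi>] closure_endomorphism_imp[OF \<psi>])
  qed
  show ?thesis
    unfolding closure_endomorphism_iff using imp mono ext idem by (blast intro: monoI)
qed

lemma fixpoint_set_wedge:
  fixes \<phi> \<psi> :: "'a :: hilbert_algebra \<Rightarrow> 'a"
  assumes \<phi>: "closure_endomorphism \<phi>" and \<psi>: "closure_endomorphism \<psi>"
  shows "fixpoint_set (\<lambda>a. wedge (\<phi> a) (\<psi> a)) = fixpoint_set \<phi> \<nabla> fixpoint_set \<psi>"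
proof (intro Set.set_eqI iffI)
  fix a
  assume "a \<in> fixpoint_set (\<lambda>a. wedge (\<phi> a) (\<psi> a))"
  then have "a = wedge (\<phi> a) (\<psi> a)"
    by (simp add: fixpoint_set_def)
  moreover have "\<phi> a \<in> fixpoint_set \<phi>" "\<psi> a \<in> fixpoint_set \<psi>"
    using \<phi> \<psi> by (simp_all add: fixpoint_set_def closure_endomorphismD(4))
  ultimately show "a \<in> fixpoint_set \<phi> \<nabla> fixpoint_set \<psi>"
    unfolding nabla_def using closure_endomorphisms_compatible[OF \<phi> \<psi>] by blast
next
  note W = compatible_wedge[OF closure_endomorphisms_compatible[OF \<phi> \<psi>]]
  fix a
  assume "a \<in> fixpoint_set \<phi> \<nabla> fixpoint_set \<psi>"
  then obtain x y where a: "a = wedge x y" and xy: "compatible x y" "\<phi> x = x" "\<psi> y = y"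
    unfolding nabla_def fixpoint_set_def by blast
  note V = compatible_wedge[OF xy(1), folded a]
  have "\<phi> a \<le> x" "\<psi> a \<le> y"
    using closure_endomorphismD(2)[OF \<phi> V(1)] closure_endomorphismD(2)[OF \<psi> V(2)] xy by simp_all
  then have "wedge (\<phi> a) (\<psi> a) \<le> a"
    by (meson V(4) W(1,2) order_trans)
  moreover have "a \<le> wedge (\<phi> a) (\<psi> a)"
    by (intro W(4) closure_endomorphismD(3) \<phi> \<psi>)
  ultimately show "a \<in> fixpoint_set (\<lambda>a. wedge (\<phi> a) (\<psi> a))"
    by (simp add: fixpoint_set_def antisym)
qed

section \<open>Special closure retracts as fixpoint sets\<close>

lemma is_minimum_fixpoint_set:
  assumes "closure_endomorphism \<phi>"
  shows "is_minimum (upper_part (fixpoint_set \<phi>) a) (\<phi> a)"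
  using closure_endomorphismD(2-4)[OF assms]
  by (fastforce simp: is_minimum_def upper_part_def fixpoint_set_def)

lemma special_fixpoint_set:
  assumes "closure_endomorphism \<phi>"
  shows "special (fixpoint_set \<phi>)"
  unfolding special_def
proof (intro allI ballI exI conjI)
  note \<phi> = closure_endomorphismD[OF assms]
  fix a b
  assume "b \<in> fixpoint_set \<phi>"
  then have b: "\<phi> b = b"
    by (simp add: fixpoint_set_def)
  show "(\<phi> a \<leadsto> a) \<leadsto> a \<in> fixpoint_set \<phi>"
    by (simp add: closure_endomorphism_imp_imp[OF assms] fixpoint_set_def \<phi>(4))
  \<comment> \<open>As \<open>b\<close> is a fixpoint, \<open>p \<leadsto> b = \<phi> p \<leadsto> b\<close> for every \<open>p\<close>; here \<open>\<phi> p = 1\<close>.\<close>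
  have "(\<phi> a \<leadsto> a) \<leadsto> b = \<phi> (\<phi> a \<leadsto> a) \<leadsto> b"
    using \<phi>(1)[of _ b] closure_endomorphism_imp[OF assms, of _ b] b by metis
  also have "\<phi> (\<phi> a \<leadsto> a) = 1"
    using \<phi>(1,4) by (simp add: imp_eq_one_iff)
  finally show "(\<phi> a \<leadsto> a) \<leadsto> b = b"
    by (simp add: one_imp)
qed

lemma special_closure_retract_fixpoint_set:
  assumes "closure_endomorphism \<phi>"
  shows "special_closure_retract (fixpoint_set \<phi>)"
  unfolding special_closure_retract_def closure_retract_def
  using special_fixpoint_set[OF assms] is_minimum_fixpoint_set[OF assms] by blast

lemma special_subalgebra_fixpoint_set:
  assumes "closure_endomorphism \<phi>"
  shows "special_subalgebra (fixpoint_set \<phi>)"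
  unfolding special_subalgebra_def subalgebra_def
  using special_fixpoint_set[OF assms] closure_endomorphism_one[OF assms]
    closure_endomorphismD(1)[OF assms]
  by (simp add: fixpoint_set_def)

lemma fixpoint_set_subset_iff:
  assumes \<phi>: "closure_endomorphism \<phi>" and \<psi>: "closure_endomorphism \<psi>"
  shows "fixpoint_set \<psi> \<subseteq> fixpoint_set \<phi> \<longleftrightarrow> \<phi> \<le> \<psi>"
proof
  assume sub: "fixpoint_set \<psi> \<subseteq> fixpoint_set \<phi>"
  show "\<phi> \<le> \<psi>"
  proof (rule le_funI)
    fix x
    have "\<psi> x \<in> fixpoint_set \<psi>"
      using closure_endomorphismD(4)[OF \<psi>] by (simp add: fixpoint_set_def)
    then have "\<phi> (\<psi> x) = \<psi> x"
      using sub by (auto simp: fixpoint_set_def)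
    then show "\<phi> x \<le> \<psi> x"
      using closure_endomorphismD(2)[OF \<phi>, of x "\<psi> x"] closure_endomorphismD(3)[OF \<psi>] by simp
  qed
next
  assume le: "\<phi> \<le> \<psi>"
  show "fixpoint_set \<psi> \<subseteq> fixpoint_set \<phi>"
  proof
    fix x
    assume "x \<in> fixpoint_set \<psi>"
    then have "\<phi> x \<le> x"
      using le_funD[OF le, of x] by (simp add: fixpoint_set_def)
    then show "x \<in> fixpoint_set \<phi>"
      using closure_endomorphismD(3)[OF \<phi>] by (simp add: fixpoint_set_def antisym)
  qed
qed

text \<open>
  Specialness is used twice. With \<open>x \<leadsto> b\<close> in place of \<open>a\<close> it yields a \<open>p\<close> with
  \<open>p \<leadsto> (x \<leadsto> b) \<in> R\<close>, and exchange absorbs \<open>p\<close> into \<open>b\<close>, so \<open>x \<leadsto> b \<in> R\<close>. For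
  \<open>c = \<phi> (x \<leadsto> y)\<close>, on the other hand, it yields a \<open>p\<close> with \<open>\<phi> y \<le> p \<leadsto> y\<close> and \<open>p \<leadsto> c = c\<close>,
  so that \<open>x \<leadsto> \<phi> y \<le> p \<leadsto> (x \<leadsto> y) \<le> p \<leadsto> c = c\<close>.
\<close>

lemma special_closure_retract_is_fixpoint_set:
  fixes R :: "'a :: hilbert_algebra set"
  assumes "special_closure_retract R"
  obtains \<phi> where "closure_endomorphism \<phi>" and "fixpoint_set \<phi> = R"
proof -
  have sp: "special R" and "\<forall>a. \<exists>m. is_minimum (upper_part R a) m"
    using assms by (auto simp: special_closure_retract_def closure_retract_def)
  then obtain \<phi> where "\<And>a. is_minimum (upper_part R a) (\<phi> a)"
    by metis
  then have R: "\<phi> a \<in> R" and ext: "a \<le> \<phi> a" and least: "x \<in> R \<Longrightarrow> a \<le> x \<Longrightarrow> \<phi> a \<le> x" for a x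
    by (auto simp: is_minimum_def upper_part_def)
  have fixed: "\<phi> x = x" if "x \<in> R" for x
    using least[OF that order_refl] ext by (rule antisym)
  have imp_R: "x \<leadsto> b \<in> R" if "b \<in> R" for x b
  proof -
    obtain p where "p \<leadsto> (x \<leadsto> b) \<in> R" "p \<leadsto> b = b"
      using sp \<open>b \<in> R\<close> unfolding special_def by blast
    then show ?thesis
      by (simp add: imp_exchange[of p])
  qed
  have imp: "\<phi> (x \<leadsto> y) = x \<leadsto> \<phi> y" for x y
  proof (rule antisym)
    show "\<phi> (x \<leadsto> y) \<le> x \<leadsto> \<phi> y"
      by (intro least imp_R R imp_mono_right ext)
    obtain p where p: "p \<leadsto> y \<in> R" "p \<leadsto> \<phi> (x \<leadsto> y) = \<phi> (x \<leadsto> y)"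
      using sp R unfolding special_def by blast
    have "x \<leadsto> \<phi> y \<le> x \<leadsto> (p \<leadsto> y)"
      by (intro imp_mono_right least p(1) le_imp)
    also have "\<dots> = p \<leadsto> (x \<leadsto> y)"
      by (rule imp_exchange)
    also have "\<dots> \<le> p \<leadsto> \<phi> (x \<leadsto> y)"
      by (intro imp_mono_right ext)
    finally show "x \<leadsto> \<phi> y \<le> \<phi> (x \<leadsto> y)"
      by (simp only: p(2))
  qed
  have "mono \<phi>"
    by (meson R ext least monoI order_trans)
  then have "closure_endomorphism \<phi>"
    unfolding closure_endomorphism_iff using imp ext fixed[OF R] by blast
  moreover have "fixpoint_set \<phi> = R"
    using R fixed unfolding fixpoint_set_def by (auto, metis)
  ultimately show thesis
    using that by blast
qed

section \<open>The order structures\<close>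

lemma partial_order_inclusion_poset: "partial_order (inclusion_poset \<C>)"
  by unfold_locales (auto simp: inclusion_poset_def)

lemma partial_order_CE: "partial_order CE"
  by unfold_locales (auto simp: CE_def)

lemma least_CE: "least CE id (carrier CE)"
  by (auto simp: CE_def least_def le_fun_def closure_endomorphism_id closure_endomorphismD(3))

lemma greatest_CE: "greatest CE (\<lambda>_. 1) (carrier CE)"
  by (auto simp: CE_def greatest_def le_fun_def closure_endomorphism_const_one le_one)

lemma bounded_order_embedding_fixpoint_set:
  "bounded_order_embedding (CE :: ('a::hilbert_algebra \<Rightarrow> 'a) gorder)
     (inv_gorder special_subalgebras) fixpoint_set"
proof -
  interpret CE: partial_order "CE :: ('a \<Rightarrow> 'a) gorder"
    by (rule partial_order_CE)
  interpret sub: partial_order "special_subalgebras :: 'a set gorder"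
    unfolding special_subalgebras_def by (rule partial_order_inclusion_poset)
  have maps: "fixpoint_set \<in> carrier CE \<rightarrow> carrier (special_subalgebras :: 'a set gorder)"
    by (simp add: CE_def special_subalgebras_def inclusion_poset_def special_subalgebra_fixpoint_set)
  have "order_emb (CE :: ('a \<Rightarrow> 'a) gorder) (inv_gorder special_subalgebras) fixpoint_set"
    unfolding order_emb_def
    using CE.weak_partial_order_axioms sub.dual_weak_order
    by (simp add: CE_def special_subalgebras_def inclusion_poset_def fixpoint_set_subset_iff)
  moreover have "greatest special_subalgebras (fixpoint_set x) (carrier special_subalgebras)"
    if "least CE x (carrier CE)" for x :: "'a \<Rightarrow> 'a"
  proof -
    have "x = id"
      using that least_CE by (rule CE.least_unique)
    moreover have "fixpoint_set id = (UNIV :: 'a set)"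
      by (simp add: fixpoint_set_def)
    ultimately show ?thesis
      using special_subalgebra_fixpoint_set[OF closure_endomorphism_id, where 'a = 'a]
      by (simp add: greatest_def special_subalgebras_def inclusion_poset_def)
  qed
  moreover have "least special_subalgebras (fixpoint_set x) (carrier special_subalgebras)"
    if "greatest CE x (carrier CE)" for x :: "'a \<Rightarrow> 'a"
  proof -
    have "x = (\<lambda>_. 1)"
      using that greatest_CE by (rule CE.greatest_unique)
    moreover have "fixpoint_set (\<lambda>_. 1) = {1 :: 'a}"
      by (auto simp: fixpoint_set_def)
    ultimately show ?thesis
      using special_subalgebra_fixpoint_set[OF closure_endomorphism_const_one, where 'a = 'a]
      by (auto simp: least_def special_subalgebras_def inclusion_poset_def special_subalgebra_def
          subalgebra_def)
  qed
  ultimately show ?thesis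
    unfolding bounded_order_embedding_def using maps by simp
qed

lemma fixpoint_set_image_CE:
  "fixpoint_set ` carrier (CE :: ('a::hilbert_algebra \<Rightarrow> 'a) gorder) =
     carrier special_closure_retracts"
proof -
  have "R \<in> fixpoint_set ` {\<phi>. closure_endomorphism \<phi>} \<longleftrightarrow> special_closure_retract R"
    for R :: "'a set"
    using special_closure_retract_fixpoint_set special_closure_retract_is_fixpoint_set[of R]
    by blast
  then show ?thesis
    by (auto simp: CE_def special_closure_retracts_def inclusion_poset_def)
qed

lemma special_closure_retract_Int:
  assumes "special_closure_retract S" and "special_closure_retract T"
  shows "special_closure_retract (S \<inter> T)"
proof -
  obtain \<phi> where \<phi>: "closure_endomorphism \<phi>" "fixpoint_set \<phi> = S"
    using assms(1) by (rule special_closure_retract_is_fixpoint_set)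
  obtain \<psi> where \<psi>: "closure_endomorphism \<psi>" "fixpoint_set \<psi> = T"
    using assms(2) by (rule special_closure_retract_is_fixpoint_set)
  show ?thesis
    using special_closure_retract_fixpoint_set[OF closure_endomorphism_comp[OF \<phi>(1) \<psi>(1)]]
    by (simp only: fixpoint_set_comp[OF \<phi>(1) \<psi>(1)] \<phi>(2) \<psi>(2))
qed

lemma special_closure_retract_nabla:
  assumes "special_closure_retract S" and "special_closure_retract T"
  shows "special_closure_retract (S \<nabla> T)"
proof -
  obtain \<phi> where \<phi>: "closure_endomorphism \<phi>" "fixpoint_set \<phi> = S"
    using assms(1) by (rule special_closure_retract_is_fixpoint_set)
  obtain \<psi> where \<psi>: "closure_endomorphism \<psi>" "fixpoint_set \<psi> = T"
    using assms(2) by (rule special_closure_retract_is_fixpoint_set)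
  show ?thesis
    using special_closure_retract_fixpoint_set[OF closure_endomorphism_wedge[OF \<phi>(1) \<psi>(1)]]
    by (simp only: fixpoint_set_wedge[OF \<phi>(1) \<psi>(1)] \<phi>(2) \<psi>(2))
qed

lemma special_closure_retract_one:
  assumes "special_closure_retract S"
  shows "1 \<in> S"
proof -
  obtain m where "m \<in> S" "1 \<le> m"
    using assms
    unfolding special_closure_retract_def closure_retract_def is_minimum_def upper_part_def by blast
  then show ?thesis
    by (simp add: one_le_iff)
qed

lemma nabla_upper:
  assumes "special_closure_retract S" and "special_closure_retract T"
  shows "S \<subseteq> S \<nabla> T" and "T \<subseteq> S \<nabla> T"
  unfolding nabla_def
  using assms[THEN special_closure_retract_one] by (force simp: compatible_one)+

lemma nabla_least:
  assumes "special_closure_retract U" and "S \<subseteq> U" and "T \<subseteq> U"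
  shows "S \<nabla> T \<subseteq> U"
proof -
  obtain \<phi> where \<phi>: "closure_endomorphism \<phi>" "fixpoint_set \<phi> = U"
    using assms(1) by (rule special_closure_retract_is_fixpoint_set)
  have "wedge x y \<in> U" if "x \<in> U" "y \<in> U" "compatible x y" for x y
  proof -
    note W = compatible_wedge[OF that(3)]
    have "\<phi> (wedge x y) \<le> wedge x y"
      using that \<phi>(2) closure_endomorphismD(2)[OF \<phi>(1) W(1)]
        closure_endomorphismD(2)[OF \<phi>(1) W(2)]
      by (intro W(4)) (auto simp: fixpoint_set_def)
    then show ?thesis
      using closure_endomorphismD(3)[OF \<phi>(1)] \<phi>(2) by (auto simp: fixpoint_set_def antisym)
  qed
  with assms(2,3) show ?thesis
    unfolding nabla_def by blast
qed

lemma lattice_special_closure_retracts: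
  defines "L \<equiv> (special_closure_retracts :: 'a::hilbert_algebra set gorder)"
  shows "lattice L"
    and "\<lbrakk>S \<in> carrier L; T \<in> carrier L\<rbrakk> \<Longrightarrow> S \<sqinter>\<^bsub>L\<^esub> T = S \<inter> T"
    and "\<lbrakk>S \<in> carrier L; T \<in> carrier L\<rbrakk> \<Longrightarrow> S \<squnion>\<^bsub>L\<^esub> T = S \<nabla> T"
proof -
  interpret partial_order L
    unfolding L_def special_closure_retracts_def by (rule partial_order_inclusion_poset)
  have glb: "is_glb L (S \<inter> T) {S, T}" if "S \<in> carrier L" "T \<in> carrier L" for S T
    using that special_closure_retract_Int
    by (auto simp: L_def special_closure_retracts_def inclusion_poset_def greatest_def Lower_def)
  have lub: "is_lub L (S \<nabla> T) {S, T}" if "S \<in> carrier L" "T \<in> carrier L" for S T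
    using that special_closure_retract_nabla[of S T] nabla_upper[of S T] nabla_least[of _ S T]
    by (auto simp: L_def special_closure_retracts_def inclusion_poset_def least_def Upper_def)
  show "lattice L"
    by unfold_locales (use glb lub in blast)+
  show "S \<sqinter>\<^bsub>L\<^esub> T = S \<inter> T" if "S \<in> carrier L" "T \<in> carrier L"
    unfolding meet_def inf_def using glb[OF that] by (metis some_equality greatest_unique)
  show "S \<squnion>\<^bsub>L\<^esub> T = S \<nabla> T" if "S \<in> carrier L" "T \<in> carrier L"
    unfolding join_def sup_def using lub[OF that] by (metis some_equality least_unique)
qed

theorem theorem4p3:
  shows
    "partial_order (CE :: ('a::hilbert_algebra \<Rightarrow> 'a) gorder) \<and>
     least CE (id :: 'a \<Rightarrow> 'a) (carrier CE) \<and>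
     greatest CE ((\<lambda>_. 1) :: 'a \<Rightarrow> 'a) (carrier CE) \<and>
     partial_order (inv_gorder (special_subalgebras :: 'a set gorder)) \<and>
     bounded_order_embedding CE (inv_gorder special_subalgebras)
       (fixpoint_set :: ('a \<Rightarrow> 'a) \<Rightarrow> 'a set) \<and>
     (fixpoint_set :: ('a \<Rightarrow> 'a) \<Rightarrow> 'a set) ` carrier CE = carrier special_closure_retracts \<and>
     lattice (special_closure_retracts :: 'a set gorder) \<and>
     (\<forall>S \<in> carrier special_closure_retracts. \<forall>T \<in> carrier special_closure_retracts.
        S \<sqinter>\<^bsub>special_closure_retracts\<^esub> T = S \<inter> (T :: 'a set) \<and>
        S \<squnion>\<^bsub>special_closure_retracts\<^esub> T = S \<nabla> T) \<and>
     (\<forall>\<phi> \<in> carrier CE. \<forall>R. R = fixpoint_set \<phi> \<longrightarrow>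
        (\<forall>a :: 'a. is_minimum (upper_part R a) (\<phi> a)))"
proof (intro conjI ballI allI impI)
  show "partial_order (inv_gorder (special_subalgebras :: 'a set gorder))"
    unfolding special_subalgebras_def
    by (intro partial_order.dual_order partial_order_inclusion_poset)
  fix \<phi> :: "'a \<Rightarrow> 'a" and R a
  assume "\<phi> \<in> carrier CE" "R = fixpoint_set \<phi>"
  then show "is_minimum (upper_part R a) (\<phi> a)"
    by (simp add: CE_def is_minimum_fixpoint_set)
qed (rule partial_order_CE least_CE greatest_CE bounded_order_embedding_fixpoint_set
    fixpoint_set_image_CE lattice_special_closure_retracts; assumption)+

end
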